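(* For every timeslot $n\in\mathcal N=\{1,\dots,N\}$, the achievable short-packet uplink and downlink secrecy rates $R^{sec}_u[n]$ and $R^{sec}_d[n]$ (defined in the context) satisfy the lower bounds $$R^{sec}_u[n]\ \ge\ \log_2(1+\gamma_r[n])-\sqrt{\frac{V(\gamma_r[n])}{l_u[n]}}\,Q^{-1}(\varepsilon_r)-\log_2(1+\tilde\gamma_{ae}[n])-\sqrt{\frac{V(\tilde\gamma_{ae}[n])}{l_u[n]}}\,Q^{-1}(\eta_e)$$ and $$R^{sec}_d[n]\ \ge\ \log_2(1+\gamma_b[n])-\sqrt{\frac{V(\gamma_b[n])}{l_d[n]}}\,Q^{-1}(\varepsilon_b)-\log_2(1+\tilde\gamma_{re}[n])-\sqrt{\frac{V(\tilde\gamma_{re}[n])}{l_d[n]}}\,Q^{-1}(\eta_e),$$ where $$\tilde\gamma_{ae}[n]=\frac{p_a[n]\rho_e[n]}{(\|\mathbf q_a-\tilde{\mathbf q}_e\|-\Delta_e)^\alpha},\qquad \tilde\gamma_{re}[n]=\frac{p_r[n]\rho_e[n]}{(\|\mathbf q_r[n]-\tilde{\mathbf q}_e\|-\Delta_e)^2}.$$ (The right-hand sides are denoted $\tilde R^{sec}_u[n]$ and $\tilde R^{sec}_d[n]$, respectively.)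
   Context: Notation: $[x]_+=\max\{x,0\}$; $\|\cdot\|$ is the Euclidean norm; $e$ is Euler's number; $Q(x)=\int_x^\infty \frac{1}{\sqrt{2\pi}}e^{-r^2/2}\,dr$ and $Q^{-1}$ is its inverse; the channel dispersion is $V(\gamma)=(\log_2 e)^2\,[1-(1+\gamma)^{-2}]$. The random variable $\zeta[n]$ is exponentially distributed with mean $1$, and $\mathbb E_{\zeta[n]}$ denotes expectation with respect to it. The points $\mathbf q_a,\mathbf q_b,\mathbf q_e,\mathbf q_r[n]\in\mathbb R^3$ are the locations of the transmitter (Alice), the receiver (Bob), the eavesdropper (Eve) and the UAV relay in timeslot $n$. Eve's location is only known up to an estimate $\tilde{\mathbf q}_e\in\mathbb R^3$ with uncertainty radius $\Delta_e$: $\|\mathbf q_e-\tilde{\mathbf q}_e\|\le\Delta_e$. It is assumed that the uncertainty radius does not exceed the distances from Alice and from the relay to the estimate: $\|\mathbf q_a-\tilde{\mathbf q}_e\|\ge\Delta_e$ and $\|\mathbf q_r[n]-\tilde{\mathbf q}_e\|\ge\Delta_e$. Here $p_a[n],p_r[n]\ge0$ are the transmit powers per channel use of Alice and of the relay; $\rho_r[n],\rho_b[n],\rho_e[n]$ are the ratios of the reference path-loss gain to the Gaussian noise powers at the relay, Bob and Eve; $\alpha$ is the terrestrial path-loss exponent (typically $2<\alpha\le4$); $l_u[n],l_d[n]$, positive integers, are the uplink and downlink blocklengths; $\varepsilon_r,\varepsilon_b$ are the decoding error probabilities at the relay and at Bob; $\eta_e$ is the security constraint in terms of information leakage to Eve.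 The signal-to-noise ratios are $$\gamma_r[n]=\frac{p_a[n]\rho_r[n]}{\|\mathbf q_r[n]-\mathbf q_a\|^2},\quad \gamma_{ae}[n]=\frac{p_a[n]\rho_e[n]}{\|\mathbf q_a-\mathbf q_e\|^\alpha}\,\zeta[n],\quad \gamma_b[n]=\frac{p_r[n]\rho_b[n]}{\|\mathbf q_r[n]-\mathbf q_b\|^2},\quad \gamma_{re}[n]=\frac{p_r[n]\rho_e[n]}{\|\mathbf q_r[n]-\mathbf q_e\|^2}.$$ The achievable secrecy rates (bits per channel use) are $$R^{sec}_u[n]=\mathbb E_{\zeta[n]}\left\{\left[\log_2\!\left(\frac{1+\gamma_r[n]}{1+\gamma_{ae}[n]}\right)-\sqrt{\frac{V(\gamma_r[n])}{l_u[n]}}\,Q^{-1}(\varepsilon_r)-\sqrt{\frac{V(\gamma_{ae}[n])}{l_u[n]}}\,Q^{-1}(\eta_e)\right]_+\right\},$$ $$R^{sec}_d[n]=\left[\log_2\!\left(\frac{1+\gamma_b[n]}{1+\gamma_{re}[n]}\right)-\sqrt{\frac{V(\gamma_b[n])}{l_d[n]}}\,Q^{-1}(\varepsilon_b)-\sqrt{\frac{V(\gamma_{re}[n])}{l_d[n]}}\,Q^{-1}(\eta_e)\right]_+.$$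
   Formalization: The formal theorem adds the assumption η_e ≤ 1/2 (so Q^{-1}(η_e) ≥ 0); for every η_e in (1/2,1) the downlink bound fails at small eavesdropper SNR. When the distance to the estimate equals Δ_e, the worst-case SNR is read as +∞ (0 at zero power). *)

theory Defs
  imports "HOL-Probability.Probability"
begin

definition gaussian_Q :: "real \<Rightarrow> real" where
  "gaussian_Q x = (LBINT r:{x..}. 1 / sqrt (2 * pi) * exp (- (r ^ 2) / 2))"

text \<open>The function \<^term>\<open>gaussian_Q\<close> is a bijection from the reals onto the open interval
  from 0 to 1, so the following inverse is meaningful only for arguments in that interval.\<close>

definition gaussian_Q_inv :: "real \<Rightarrow> real" where
  "gaussian_Q_inv = inv gaussian_Q"

definition dispersion :: "real \<Rightarrow> real" where
  "dispersion \<gamma> = (log 2 (exp 1)) ^ 2 * (1 - 1 / (1 + \<gamma>) ^ 2)"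

definition pos_part :: "real \<Rightarrow> real" where
  "pos_part x = max x 0"

text \<open>Short-packet secrecy rate before taking the positive part: SNR \<open>\<gamma>\<close> at the legitimate
  receiver, SNR \<open>\<gamma>e\<close> at the eavesdropper, blocklength \<open>l\<close>, decoding error probability \<open>\<epsilon>\<close>,
  leakage \<open>\<eta>\<close>.\<close>

definition secrecy_expr :: "real \<Rightarrow> real \<Rightarrow> nat \<Rightarrow> real \<Rightarrow> real \<Rightarrow> real" where
  "secrecy_expr \<gamma> \<gamma>e l \<epsilon> \<eta> =
     log 2 ((1 + \<gamma>) / (1 + \<gamma>e))
       - sqrt (dispersion \<gamma> / real l) * gaussian_Q_inv \<epsilon>
       - sqrt (dispersion \<gamma>e / real l) * gaussian_Q_inv \<eta>"

text \<open>A worst-case eavesdropper SNR is infinite when the transmitter lies on the boundary of the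
  uncertainty ball (and transmits with nonzero power). It is therefore an extended real, and
  \<open>log\<^sub>2 (1 + \<gamma>)\<close> and the dispersion are extended to infinity by their limits.\<close>

definition log2_one_plus_ereal :: "ereal \<Rightarrow> ereal" where
  "log2_one_plus_ereal \<gamma> = (if \<gamma> = \<infinity> then \<infinity> else ereal (log 2 (1 + real_of_ereal \<gamma>)))"

definition dispersion_ereal :: "ereal \<Rightarrow> real" where
  "dispersion_ereal \<gamma> = (if \<gamma> = \<infinity> then (log 2 (exp 1)) ^ 2 else dispersion (real_of_ereal \<gamma>))"

definition secrecy_lower_bound :: "real \<Rightarrow> ereal \<Rightarrow> nat \<Rightarrow> real \<Rightarrow> real \<Rightarrow> ereal" where
  "secrecy_lower_bound \<gamma> \<gamma>e l \<epsilon> \<eta> =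
     ereal (log 2 (1 + \<gamma>))
       - ereal (sqrt (dispersion \<gamma> / real l) * gaussian_Q_inv \<epsilon>)
       - log2_one_plus_ereal \<gamma>e
       - ereal (sqrt (dispersion_ereal \<gamma>e / real l) * gaussian_Q_inv \<eta>)"

lemma secrecy_lower_bound_finite:
  "secrecy_lower_bound \<gamma> (ereal \<gamma>e) l \<epsilon> \<eta> = ereal (
     log 2 (1 + \<gamma>)
       - sqrt (dispersion \<gamma> / real l) * gaussian_Q_inv \<epsilon>
       - log 2 (1 + \<gamma>e)
       - sqrt (dispersion \<gamma>e / real l) * gaussian_Q_inv \<eta>)"
  by (simp add: secrecy_lower_bound_def log2_one_plus_ereal_def dispersion_ereal_def)

lemma secrecy_lower_bound_infinite: "secrecy_lower_bound \<gamma> \<infinity> l \<epsilon> \<eta> = - \<infinity>"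
  by (simp add: secrecy_lower_bound_def log2_one_plus_ereal_def)

text \<open>Extended-real quotients of the form used for the worst-case SNRs are ordinary real quotients
  for a nonzero denominator; division of a positive number by 0 gives infinity, and \<open>0 / 0 = 0\<close>
  (zero power gives zero SNR).\<close>

lemma ereal_quotient_cases:
  fixes c d :: real
  assumes "c \<ge> 0"
  shows "ereal c / ereal d = (if d \<noteq> 0 then ereal (c / d) else if c > 0 then \<infinity> else 0)"
  using assms by (auto simp: divide_ereal_def divide_inverse)

end

theory Submission imports Defs begin

text \<open>Since \<open>\<eta> \<le> 1 / 2\<close>, the quantile \<open>Q\<^sup>-\<^sup>1(\<eta>)\<close> is nonnegative, so the rate is decreasing and
  convex in the eavesdropper's SNR: both \<open>log\<^sub>2 (1 + x)\<close> and \<open>sqrt (1 - (1 + x)\<^sup>-\<^sup>2)\<close> are increasing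
  and concave. Jensen's inequality replaces the fading gain by its mean 1, and the triangle
  inequality bounds the resulting SNR by its worst case over the uncertainty ball.\<close>

section \<open>Gaussian tail function and the sign of its inverse\<close>

definition std_normal :: "real measure" where
  "std_normal = density lborel std_normal_density"

interpretation std_normal: real_distribution std_normal
  using prob_space_normal_density[of 1 0]
  by (simp add: std_normal_def real_distribution_def real_distribution_axioms_def)

lemma measure_std_normal:
  assumes "A \<in> sets borel"
  shows "measure std_normal A = (LBINT r:A. std_normal_density r)"
proof -
  have int: "set_integrable lborel A std_normal_density"
    using assms integrable_mult_indicator[of A lborel std_normal_density]
    by (simp add: set_integrable_def)
  have "emeasure std_normal A = (\<integral>\<^sup>+ r. ennreal (indicator A r * std_normal_density r) \<partial>lborel)"
    using assms unfolding std_normal_def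
    by (subst emeasure_density) (auto intro!: nn_integral_cong split: split_indicator)
  also have "\<dots> = ennreal (LBINT r:A. std_normal_density r)"
    using int unfolding set_integrable_def set_lebesgue_integral_def
    by (subst nn_integral_eq_integral) auto
  finally show ?thesis
    by (simp add: measure_def set_lebesgue_integral_def)
qed

text \<open>Viewing the tail integral as a probability makes finite additivity and the continuity
  and limits of the cdf available.\<close>

lemma gaussian_Q_eq_measure: "gaussian_Q x = measure std_normal {x..}"
  by (simp add: gaussian_Q_def measure_std_normal std_normal_density_def)

lemma measure_std_normal_singleton: "measure std_normal {x} = 0"
proof -
  have "AE r in lborel. indicator {x} r *\<^sub>R std_normal_density r = 0"
    using AE_lborel_singleton[of x] by eventually_elim simp
  then show ?thesis
    unfolding measure_std_normal[OF borel_closed[OF closed_singleton]] set_lebesgue_integral_def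
    by (rule integral_eq_zero_AE)
qed

text \<open>The closed tail and the closed half-line of the cdf overlap in the single point
  \<open>x\<close>, which is a null set.\<close>

lemma gaussian_Q_eq_cdf: "gaussian_Q x = 1 - cdf std_normal x"
proof -
  have "{..<x} \<union> {x..} = UNIV"
    by auto
  then have "1 = measure std_normal ({..<x} \<union> {x..})"
    using std_normal.prob_space by simp
  also have "\<dots> = measure std_normal {..<x} + gaussian_Q x"
    unfolding gaussian_Q_eq_measure by (subst std_normal.finite_measure_Union) auto
  also have "measure std_normal {..<x} = measure std_normal ({..<x} \<union> {x})"
    by (subst std_normal.finite_measure_Union) (auto simp: measure_std_normal_singleton)
  also have "\<dots> = cdf std_normal x"
    by (simp add: cdf_def ivl_disj_un_singleton del: Un_insert_right)
  finally show ?thesis by simp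
qed

text \<open>The density is even, so the reflection \<open>r\<close> to \<open>-r\<close> gives both
  half-lines the same mass, and the two masses add up to 1.\<close>

lemma gaussian_Q_0: "gaussian_Q 0 = 1 / 2"
proof -
  have "gaussian_Q 0 = measure std_normal {..0}"
    unfolding gaussian_Q_eq_measure measure_std_normal[OF borel_closed[OF closed_atLeast]]
      measure_std_normal[OF borel_closed[OF closed_atMost]] set_lebesgue_integral_def
    by (subst lborel_integral_real_affine[where c = "-1" and t = 0])
       (auto intro!: Bochner_Integration.integral_cong simp: std_normal_density_def split: split_indicator)
  then show ?thesis
    using gaussian_Q_eq_cdf[of 0] by (simp add: cdf_def)
qed

lemma gaussian_Q_gt_half:
  assumes "x < 0"
  shows "1 / 2 < gaussian_Q x"
proof -
  \<comment> \<open>A rectangle under the density: width \<open>- x\<close>, and height the value at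
    \<open>x\<close>, which is the infimum of the density on \<open>{x..<0}\<close>. Its area bounds
    from below the mass gained over \<open>gaussian_Q 0\<close>.\<close>
  have "0 < - x * std_normal_density x"
    using assms normal_density_pos[of 1 0 x] by (simp add: mult_neg_pos)
  also have "\<dots> = (LBINT r:{x..<0}. std_normal_density x)"
    using assms by (simp add: set_lebesgue_integral_def)
  also have "\<dots> \<le> (LBINT r:{x..<0}. std_normal_density r)"
  proof (rule set_integral_mono)
    show "set_integrable lborel {x..<0} (\<lambda>_. std_normal_density x)"
      using assms by (simp add: set_integrable_def)
    show "set_integrable lborel {x..<0} std_normal_density"
      using integrable_mult_indicator[of "{x..<0}" lborel std_normal_density]
      by (simp add: set_integrable_def)
    fix r assume "r \<in> {x..<0}"
    then have "r\<^sup>2 \<le> x\<^sup>2"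
      by (auto simp: abs_le_square_iff[symmetric])
    then show "std_normal_density x \<le> std_normal_density r"
      by (simp add: std_normal_density_def divide_right_mono)
  qed
  also have "\<dots> = measure std_normal {x..<0}"
    by (simp add: measure_std_normal)
  finally have "0 < measure std_normal {x..<0}" .
  moreover have "measure std_normal ({x..<0} \<union> {0..}) = measure std_normal {x..<0} + gaussian_Q 0"
    unfolding gaussian_Q_eq_measure by (subst std_normal.finite_measure_Union) auto
  moreover have "{x..<0} \<union> {0..} = {x..}"
    using assms by auto
  ultimately show ?thesis
    by (simp add: gaussian_Q_0 gaussian_Q_eq_measure[of x])
qed

lemma gaussian_Q_surj:
  assumes "0 < \<eta>" "\<eta> < 1"
  shows "\<exists>x. gaussian_Q x = \<eta>"
proof -
  have "eventually (\<lambda>x. cdf std_normal x > 1 - \<eta>) at_top"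
    using std_normal.cdf_lim_at_top_prob assms(1) by (auto intro: order_tendstoD)
  then obtain b where b: "\<And>x. x \<ge> b \<Longrightarrow> cdf std_normal x > 1 - \<eta>"
    by (auto simp: eventually_at_top_linorder)
  have "eventually (\<lambda>x. cdf std_normal x < 1 - \<eta>) at_bot"
    using std_normal.cdf_lim_at_bot assms(2) by (auto intro: order_tendstoD)
  then obtain a where a: "\<And>x. x \<le> a \<Longrightarrow> cdf std_normal x < 1 - \<eta>"
    by (auto simp: eventually_at_bot_linorder)
  \<comment> \<open>Nothing orders \<open>a\<close> and \<open>b\<close> so far;
    \<open>min a b\<close> is a left endpoint that keeps the cdf below the target and lies below
    \<open>b\<close>.\<close>
  have "\<exists>x. min a b \<le> x \<and> x \<le> b \<and> cdf std_normal x = 1 - \<eta>"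
    using a[of "min a b"] b[of b]
    by (intro IVT) (auto simp: std_normal.isCont_cdf measure_std_normal_singleton)
  then obtain x where "cdf std_normal x = 1 - \<eta>"
    by blast
  then show ?thesis
    by (intro exI[of _ x]) (simp add: gaussian_Q_eq_cdf)
qed

text \<open>Surjectivity makes \<open>gaussian_Q_inv \<eta>\<close> a genuine preimage of \<eta>. A
  negative preimage would have a tail above 1/2.\<close>

lemma gaussian_Q_inv_nonneg:
  assumes "0 < \<eta>" "\<eta> \<le> 1 / 2"
  shows "0 \<le> gaussian_Q_inv \<eta>"
proof -
  have "gaussian_Q (gaussian_Q_inv \<eta>) = \<eta>"
    unfolding gaussian_Q_inv_def using gaussian_Q_surj[of \<eta>] assms
    by (intro f_inv_into_f) auto
  then show ?thesis
    using gaussian_Q_gt_half[of "gaussian_Q_inv \<eta>"] assms by linarith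
qed

section \<open>Monotonicity in the eavesdropper's SNR\<close>

lemma dispersion_mono: "0 \<le> x \<Longrightarrow> x \<le> y \<Longrightarrow> dispersion x \<le> dispersion y"
  unfolding dispersion_def by (intro mult_left_mono diff_left_mono divide_left_mono power_mono) auto

lemma secrecy_expr_antimono:
  assumes "0 \<le> x" "x \<le> y" "0 \<le> \<gamma>" "0 \<le> gaussian_Q_inv \<eta>"
  shows "secrecy_expr \<gamma> y l \<epsilon> \<eta> \<le> secrecy_expr \<gamma> x l \<epsilon> \<eta>"
proof -
  have "log 2 ((1 + \<gamma>) / (1 + y)) \<le> log 2 ((1 + \<gamma>) / (1 + x))"
    using assms by (simp add: divide_left_mono)
  moreover have "sqrt (dispersion x / l) * gaussian_Q_inv \<eta> \<le> sqrt (dispersion y / l) * gaussian_Q_inv \<eta>"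
    using assms by (intro mult_right_mono real_sqrt_le_mono divide_right_mono dispersion_mono) auto
  ultimately show ?thesis
    by (simp add: secrecy_expr_def)
qed

text \<open>For a finite \<open>\<gamma>t\<close> the bound is the rate at \<open>\<gamma>t\<close>,
  and antitonicity applies. An infinite \<open>\<gamma>t\<close> gives the trivial bound minus
  infinity.\<close>

lemma secrecy_lower_bound_le_pos_part:
  assumes "0 \<le> \<gamma>" "0 \<le> \<gamma>e" "ereal \<gamma>e \<le> \<gamma>t" "0 \<le> gaussian_Q_inv \<eta>"
  shows "secrecy_lower_bound \<gamma> \<gamma>t l \<epsilon> \<eta> \<le> ereal (pos_part (secrecy_expr \<gamma> \<gamma>e l \<epsilon> \<eta>))"
proof (cases \<gamma>t)
  case (real g)
  have "secrecy_lower_bound \<gamma> \<gamma>t l \<epsilon> \<eta> = ereal (secrecy_expr \<gamma> g l \<epsilon> \<eta>)"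
    using assms real
    by (simp add: secrecy_lower_bound_finite secrecy_expr_def log_divide)
  also have "\<dots> \<le> ereal (secrecy_expr \<gamma> \<gamma>e l \<epsilon> \<eta>)"
    using assms real by (simp add: secrecy_expr_antimono)
  also have "\<dots> \<le> ereal (pos_part (secrecy_expr \<gamma> \<gamma>e l \<epsilon> \<eta>))"
    by (simp add: pos_part_def)
  finally show ?thesis .
qed (use assms in \<open>auto simp: secrecy_lower_bound_infinite\<close>)

text \<open>The case \<open>D = 0\<close> is included: the left-hand side is then the junk value 0.\<close>

lemma ereal_divide_le_ereal_quotient:
  fixes c d D :: real
  assumes "0 \<le> c" "0 \<le> d" "d \<le> D"
  shows "ereal (c / D) \<le> ereal c / ereal d"
  using assms by (auto simp: ereal_quotient_cases intro!: divide_left_mono mult_pos_pos)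

section \<open>Convexity in the eavesdropper's SNR\<close>

lemma convex_on_secrecy_expr:
  assumes "0 \<le> \<gamma>" "0 \<le> gaussian_Q_inv \<eta>"
  shows "convex_on {0<..} (\<lambda>x. secrecy_expr \<gamma> x l \<epsilon> \<eta>)"
proof -
  define A where "A = log 2 (1 + \<gamma>) - sqrt (dispersion \<gamma> / real l) * gaussian_Q_inv \<epsilon>"
  define k where "k = sqrt ((log 2 (exp 1))\<^sup>2 / real l) * gaussian_Q_inv \<eta>"
  define u :: "real \<Rightarrow> real" where "u x = sqrt (1 - (inverse (1 + x))\<^sup>2)" for x
  have k: "0 \<le> k"
    using assms by (simp add: k_def)
  have u: "secrecy_expr \<gamma> x l \<epsilon> \<eta> = A - log 2 (1 + x) - k * u x" if "0 < x" for x
    using that assms(1)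
    by (simp add: secrecy_expr_def A_def k_def u_def dispersion_def log_divide real_sqrt_mult
        real_sqrt_divide power_inverse inverse_eq_divide power_divide)
  have arg_pos: "0 < 1 - (inverse (1 + x))\<^sup>2" if "0 < x" for x :: real
    using that by (simp add: power_less_one_iff inverse_less_1_iff abs_square_less_1)
  \<comment> \<open>The derivative is shown to be nondecreasing. The point 0 is left out because the
    radicand of \<open>u\<close> vanishes there and its slope is infinite.\<close>
  have "convex_on {0<..} (\<lambda>x. A - log 2 (1 + x) - k * u x)"
  proof (rule convex_on_realI)
    show "connected {0::real<..}" by simp
  next
    fix x :: real assume "x \<in> {0<..}"
    then have x: "0 < x" by simp
    then have "((\<lambda>x. 1 - (inverse (1 + x))\<^sup>2) has_real_derivative 2 * inverse (1 + x) ^ 3) (at x)"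
      by (auto intro!: derivative_eq_intros simp: power2_eq_square power3_eq_cube)
    from DERIV_chain2[OF DERIV_real_sqrt[OF arg_pos[OF x]] this]
    have du: "(u has_real_derivative inverse (1 + x) ^ 3 / u x) (at x)"
      by (simp add: u_def[abs_def] field_simps)
    have "((\<lambda>x. log 2 (1 + x)) has_real_derivative inverse (1 + x) / ln 2) (at x)"
      using x unfolding log_def by (auto intro!: derivative_eq_intros simp: inverse_eq_divide)
    from DERIV_diff[OF DERIV_diff[OF DERIV_const this] DERIV_cmult[OF du]]
    show "((\<lambda>x. A - log 2 (1 + x) - k * u x) has_real_derivative
        - (inverse (1 + x) / ln 2) - k * (inverse (1 + x) ^ 3 / u x)) (at x)"
      by simp
  next
    fix x y :: real assume xy: "x \<in> {0<..}" "y \<in> {0<..}" "x \<le> y"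
    have inv: "inverse (1 + y) \<le> inverse (1 + x)"
      using xy by (simp add: le_imp_inverse_le)
    \<comment> \<open>This is concavity of \<open>u\<close>: in its derivative the numerator
      decreases while the denominator increases.\<close>
    have "inverse (1 + y) ^ 3 / u y \<le> inverse (1 + x) ^ 3 / u x"
    proof (rule frac_le)
      show "u x \<le> u y"
        using xy inv by (simp add: u_def power_mono del: inverse_le_iff_le)
    qed (use xy inv arg_pos[of x] in \<open>auto simp: u_def intro!: power_mono\<close>)
    then have "k * (inverse (1 + y) ^ 3 / u y) \<le> k * (inverse (1 + x) ^ 3 / u x)"
      using k by (rule mult_left_mono)
    moreover have "inverse (1 + y) / ln 2 \<le> inverse (1 + x) / ln 2"
      using inv by (rule divide_right_mono) simp
    ultimately show "- (inverse (1 + x) / ln 2) - k * (inverse (1 + x) ^ 3 / u x)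
        \<le> - (inverse (1 + y) / ln 2) - k * (inverse (1 + y) ^ 3 / u y)"
      by linarith
  qed
  then show ?thesis
    \<comment> \<open>The rewriting \<open>u\<close> holds only at positive arguments; convexity of
      the half-line makes it apply at the convex combination too.\<close>
    using convexD[of "{0::real<..}"] unfolding convex_on_def by (simp add: u)
qed

text \<open>The weighted sum of positive parts dominates both the value of \<open>f\<close> at the
  convex combination and 0, hence their maximum.\<close>

lemma convex_on_pos_part:
  assumes "convex_on S f"
  shows "convex_on S (\<lambda>x. pos_part (f x))"
proof (rule convex_onI)
  show "convex S" using assms by (rule convex_on_imp_convex)
next
  fix t :: real and x y assume t: "0 < t" "t < 1" and xy: "x \<in> S" "y \<in> S"
  have "f ((1 - t) *\<^sub>R x + t *\<^sub>R y) \<le> (1 - t) * f x + t * f y"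
    using convex_onD[OF assms, of t x y] t xy by simp
  also have "\<dots> \<le> (1 - t) * pos_part (f x) + t * pos_part (f y)"
    using t by (intro add_mono mult_left_mono) (auto simp: pos_part_def)
  finally show "pos_part (f ((1 - t) *\<^sub>R x + t *\<^sub>R y)) \<le> (1 - t) * pos_part (f x) + t * pos_part (f y)"
    using t by (simp add: pos_part_def)
qed

lemma convex_on_scale_pos:
  fixes f :: "real \<Rightarrow> real"
  assumes "convex_on {0<..} f" "0 < c"
  shows "convex_on {0<..} (\<lambda>x. f (c * x))"
proof (rule convex_onI)
  fix t x y :: real assume t: "0 < t" "t < 1" and xy: "x \<in> {0<..}" "y \<in> {0<..}"
  show "f (c * ((1 - t) *\<^sub>R x + t *\<^sub>R y)) \<le> (1 - t) * f (c * x) + t * f (c * y)"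
    using convex_onD[OF assms(1), of t "c * x" "c * y"] t xy assms(2)
    by (simp add: algebra_simps)
qed simp

section \<open>Averaging over the fading gain\<close>

lemma (in prob_space) pos_part_secrecy_expr_le_expectation:
  assumes X: "distributed M lborel X (exponential_density 1)"
    and "0 \<le> \<gamma>" "0 \<le> c" "0 \<le> gaussian_Q_inv \<eta>"
  shows "pos_part (secrecy_expr \<gamma> c l \<epsilon> \<eta>)
    \<le> expectation (\<lambda>\<omega>. pos_part (secrecy_expr \<gamma> (c * X \<omega>) l \<epsilon> \<eta>))"
proof (cases "c = 0")
  \<comment> \<open>Scaling by 0 would leave the open half-line of convexity, but here the integrand
    is constant.\<close>
  case True
  then show ?thesis by (simp add: prob_space)
next
  case False
  with \<open>0 \<le> c\<close> have c: "0 < c" by simp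
  define f where "f z = pos_part (secrecy_expr \<gamma> (c * z) l \<epsilon> \<eta>)" for z
  have [measurable]: "X \<in> borel_measurable M"
    using distributed_measurable[OF X] by simp
  have E: "expectation X = 1"
    using exponential_distributed_expectation[OF _ X] by simp
  \<comment> \<open>The integral of a non-integrable function is 0 by convention, so the mean 1
    forces integrability.\<close>
  then have int: "integrable M X"
    using not_integrable_integral_eq[of M X] by force
  \<comment> \<open>The density is positive at 0 as well, so that point is discarded as a null set
    to reach the open half-line.\<close>
  have "AE z in lborel. 0 < exponential_density 1 z \<longrightarrow> (0::real) < z"
    using AE_lborel_singleton[of "0::real"] by eventually_elim (auto simp: exponential_density_def)
  then have pos: "AE \<omega> in M. X \<omega> \<in> {0<..}"
    by (subst distributed_AE2[OF X]) (auto simp: exponential_density_def)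
  have [measurable]: "f \<in> borel_measurable borel"
    unfolding f_def pos_part_def secrecy_expr_def dispersion_def by measurable
  txt \<open>Composing with the positive part before applying Jensen makes the integrand bounded,
    so its integrability is immediate.\<close>
  have bound: "norm (f z) \<le> f 0" if "0 < z" for z
    using secrecy_expr_antimono[of 0 "c * z" \<gamma> \<eta> l \<epsilon>] that c assms
    by (auto simp: f_def pos_part_def)
  have "AE \<omega> in M. norm (f (X \<omega>)) \<le> f 0"
    using pos by eventually_elim (use bound in auto)
  then have fint: "integrable M (\<lambda>\<omega>. f (X \<omega>))"
    by (intro integrable_const_bound) auto
  have "convex_on {0<..} f"
    unfolding f_def
    by (intro convex_on_scale_pos[where f = "\<lambda>x. pos_part (secrecy_expr \<gamma> x l \<epsilon> \<eta>)"]
        convex_on_pos_part convex_on_secrecy_expr c assms)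
  \<comment> \<open>Here \<open>a = 0\<close> describes the interval \<open>{0<..}\<close>;
    \<open>b\<close> gets an arbitrary value, since this interval has no upper end.\<close>
  with jensens_inequality[where q = f and a = 0 and b = 1, OF int pos _ fint]
  have "f 1 \<le> expectation (\<lambda>\<omega>. f (X \<omega>))"
    by (simp add: E)
  then show ?thesis
    by (simp add: f_def)
qed

section \<open>The uplink and downlink bounds\<close>

theorem lemma2:
  fixes N :: nat
    and M :: "'a measure" and \<zeta> :: "nat \<Rightarrow> 'a \<Rightarrow> real"
    and q_a q_b q_e qt_e :: "real ^ 3" and q_r :: "nat \<Rightarrow> real ^ 3"
    and \<Delta>_e \<alpha> \<epsilon>_r \<epsilon>_b \<eta>_e :: real
    and p_a p_r \<rho>_r \<rho>_b \<rho>_e :: "nat \<Rightarrow> real"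
    and l_u l_d :: "nat \<Rightarrow> nat"
    and \<gamma>_r \<gamma>_b \<gamma>_re :: "nat \<Rightarrow> real" and \<gamma>_ae :: "nat \<Rightarrow> 'a \<Rightarrow> real"
    and \<gamma>t_ae \<gamma>t_re :: "nat \<Rightarrow> ereal"
    and R_u R_d :: "nat \<Rightarrow> real"
  assumes "prob_space M"
    and "\<forall>n\<in>{1..N}. distributed M lborel (\<zeta> n) (exponential_density 1)"
    and "norm (q_e - qt_e) \<le> \<Delta>_e"
    and "norm (q_a - qt_e) \<ge> \<Delta>_e"
    and "\<forall>n\<in>{1..N}. norm (q_r n - qt_e) \<ge> \<Delta>_e"
    and "\<forall>n\<in>{1..N}. p_a n \<ge> 0 \<and> p_r n \<ge> 0"
    and "\<forall>n\<in>{1..N}. \<rho>_r n > 0 \<and> \<rho>_b n > 0 \<and> \<rho>_e n > 0"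
    and "\<alpha> > 0"
    and "\<forall>n\<in>{1..N}. l_u n > 0 \<and> l_d n > 0"
    and "0 < \<epsilon>_r" "\<epsilon>_r < 1" "0 < \<epsilon>_b" "\<epsilon>_b < 1"
    and "0 < \<eta>_e" "\<eta>_e \<le> 1 / 2"
    and "\<gamma>_r = (\<lambda>n. p_a n * \<rho>_r n / norm (q_r n - q_a) ^ 2)"
    and "\<gamma>_ae = (\<lambda>n \<omega>. p_a n * \<rho>_e n / norm (q_a - q_e) powr \<alpha> * \<zeta> n \<omega>)"
    and "\<gamma>_b = (\<lambda>n. p_r n * \<rho>_b n / norm (q_r n - q_b) ^ 2)"
    and "\<gamma>_re = (\<lambda>n. p_r n * \<rho>_e n / norm (q_r n - q_e) ^ 2)"
    and "\<gamma>t_ae = (\<lambda>n. ereal (p_a n * \<rho>_e n) / ereal ((norm (q_a - qt_e) - \<Delta>_e) powr \<alpha>))"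
    and "\<gamma>t_re = (\<lambda>n. ereal (p_r n * \<rho>_e n) / ereal ((norm (q_r n - qt_e) - \<Delta>_e) ^ 2))"
    and "R_u = (\<lambda>n. \<integral>\<omega>. pos_part (secrecy_expr (\<gamma>_r n) (\<gamma>_ae n \<omega>) (l_u n) \<epsilon>_r \<eta>_e) \<partial>M)"
    and "R_d = (\<lambda>n. pos_part (secrecy_expr (\<gamma>_b n) (\<gamma>_re n) (l_d n) \<epsilon>_b \<eta>_e))"
  shows "\<forall>n\<in>{1..N}.
           ereal (R_u n) \<ge> secrecy_lower_bound (\<gamma>_r n) (\<gamma>t_ae n) (l_u n) \<epsilon>_r \<eta>_e \<and>
           ereal (R_d n) \<ge> secrecy_lower_bound (\<gamma>_b n) (\<gamma>t_re n) (l_d n) \<epsilon>_b \<eta>_e"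
proof (intro ballI conjI)
  fix n assume n: "n \<in> {1..N}"
  interpret prob_space M by fact
  have Q: "0 \<le> gaussian_Q_inv \<eta>_e"
    using assms by (intro gaussian_Q_inv_nonneg)
  have power: "0 \<le> p_a n" "0 \<le> p_r n" and \<rho>: "0 < \<rho>_r n" "0 < \<rho>_b n" "0 < \<rho>_e n"
    using assms(6,7) n by auto
  then have pa: "0 \<le> p_a n * \<rho>_e n" and pr: "0 \<le> p_r n * \<rho>_e n"
    and \<gamma>: "0 \<le> \<gamma>_r n" "0 \<le> \<gamma>_b n"
    by (simp_all add: assms(16,18))
  have dist: "norm (p - qt_e) - \<Delta>_e \<le> norm (p - q_e)" for p
    using norm_triangle_ineq[of "p - q_e" "q_e - qt_e"] assms(3) by simp
  \<comment> \<open>This is the SNR at Eve for the mean gain 1; the random SNR is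
    \<open>c * \<zeta> n \<omega>\<close>.\<close>
  define c where "c = p_a n * \<rho>_e n / norm (q_a - q_e) powr \<alpha>"
  have c: "0 \<le> c"
    using pa by (simp add: c_def)
  \<comment> \<open>The assumed distance of Alice from the estimate makes the base
    \<open>norm (q_a - qt_e) - \<Delta>_e\<close> nonnegative, so powers preserve the distance
    bound. If Alice and Eve coincide, \<open>c\<close> is 0 and the inequality still holds.\<close>
  have "ereal c \<le> \<gamma>t_ae n"
    unfolding c_def assms(20) using pa assms(4,8) dist[of q_a]
    by (intro ereal_divide_le_ereal_quotient powr_mono2) auto
  then have "secrecy_lower_bound (\<gamma>_r n) (\<gamma>t_ae n) (l_u n) \<epsilon>_r \<eta>_e
      \<le> ereal (pos_part (secrecy_expr (\<gamma>_r n) c (l_u n) \<epsilon>_r \<eta>_e))"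
    using c Q \<gamma> by (intro secrecy_lower_bound_le_pos_part)
  also have "\<dots> \<le> ereal (R_u n)"
    using pos_part_secrecy_expr_le_expectation[of "\<zeta> n" "\<gamma>_r n" c] assms(2) n c Q \<gamma>
    by (simp add: assms(17,22) c_def)
  finally show "secrecy_lower_bound (\<gamma>_r n) (\<gamma>t_ae n) (l_u n) \<epsilon>_r \<eta>_e \<le> ereal (R_u n)" .
  \<comment> \<open>The downlink SNR at Eve is deterministic, so monotonicity suffices.\<close>
  have "ereal (\<gamma>_re n) \<le> \<gamma>t_re n"
    unfolding assms(19,21) using pr n assms(5) dist[of "q_r n"]
    by (intro ereal_divide_le_ereal_quotient power_mono) auto
  moreover have "0 \<le> \<gamma>_re n"
    using pr by (simp add: assms(19))
  ultimately show "secrecy_lower_bound (\<gamma>_b n) (\<gamma>t_re n) (l_d n) \<epsilon>_b \<eta>_e \<le> ereal (R_d n)"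
    using Q \<gamma> unfolding assms(23) by (intro secrecy_lower_bound_le_pos_part)
qed

end
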